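(* Let $G$ be a finite triangle-free graph with $\gamma^{\infty}(G)=\gamma(G)$. Then $\gamma^{\infty}(G)=\theta(G)$.
   Context: All graphs are finite, simple and undirected. A dominating set of $G=(V,E)$ is a set $D\subseteq V$ such that every vertex of $V-D$ is adjacent to a vertex of $D$; $\gamma(G)$ is the minimum size of a dominating set. Eternal domination ("one guard moves"): a defender chooses a set $D_1\subseteq V$ and places one guard on each vertex of $D_1$. Then, for $i=1,2,\ldots$ in turn, an attacker (knowing the current position) chooses a vertex $r_i\in V-D_i$, and the defender responds by moving exactly one guard to $r_i$ from an adjacent vertex $v\in D_i$, so that $D_{i+1}=(D_i-\{v\})\cup\{r_i\}$. Every $D_i$ must be a dominating set. $D_1$ is an eternal dominating set (EDS) if the defender, starting from $D_1$, can respond in this way forever to every infinite sequence of attacks. The eternal domination number $\gamma^{\infty}(G)$ is the minimum size of an EDS of $G$. The clique covering number $\theta(G)$ is the minimum number $k$ of sets in a partition $V=V_1\cup\cdots\cup V_k$ such that each induced subgraph $G[V_i]$ is complete. *)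

theory Defs
  imports "Graph_Theory.Graph_Theory" "HOL-Library.Disjoint_Sets"
begin

text \<open>
  A finite simple undirected graph is a \<^locale>\<open>graph\<close>: a finite symmetric digraph without
  loops and parallel arcs. Adjacency of \<open>u\<close> and \<open>v\<close> is \<open>u \<rightarrow>\<^bsub>G\<^esub> v\<close>. The null graph is allowed.
\<close>

text \<open>The three vertices are automatically distinct in a loopfree graph.\<close>
definition triangle_free :: "('a, 'b) pre_digraph \<Rightarrow> bool" where
  "triangle_free G \<longleftrightarrow> \<not> (\<exists>u v w. u \<rightarrow>\<^bsub>G\<^esub> v \<and> v \<rightarrow>\<^bsub>G\<^esub> w \<and> w \<rightarrow>\<^bsub>G\<^esub> u)"

definition dominating_set :: "('a, 'b) pre_digraph \<Rightarrow> 'a set \<Rightarrow> bool" where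
  "dominating_set G D \<longleftrightarrow>
     D \<subseteq> verts G \<and> (\<forall>v \<in> verts G - D. \<exists>u \<in> D. u \<rightarrow>\<^bsub>G\<^esub> v)"

definition domination_number :: "('a, 'b) pre_digraph \<Rightarrow> nat" where
  "domination_number G = (LEAST k. \<exists>D. dominating_set G D \<and> card D = k)"

text \<open>
  Rounds are numbered from 0. A defender strategy \<open>s\<close> maps the list of attacks made so far (the
  current one being last) to the vertex whose guard moves to the attacked vertex; hence it cannot
  look at future attacks. \<open>guard_positions s D r i\<close> is the set of guarded vertices before the
  attack \<open>r i\<close>, when the defender starts from \<open>D\<close> and plays \<open>s\<close> against the attacks \<open>r\<close>.
\<close>
primrec guard_positions ::
    "('a list \<Rightarrow> 'a) \<Rightarrow> 'a set \<Rightarrow> (nat \<Rightarrow> 'a) \<Rightarrow> nat \<Rightarrow> 'a set" where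
  "guard_positions s D r 0 = D"
| "guard_positions s D r (Suc i) =
     (guard_positions s D r i - {s (map r [0..<Suc i])}) \<union> {r i}"

text \<open>
  The defender only has to respond as long as the attacker attacks unguarded vertices. Legality is
  therefore required of the attacks made so far, not of the whole sequence \<open>r\<close>: if all vertices
  are guarded, then no legal attack exists and the defender is safe.
\<close>
definition defending_strategy ::
    "('a, 'b) pre_digraph \<Rightarrow> 'a set \<Rightarrow> ('a list \<Rightarrow> 'a) \<Rightarrow> bool" where
  "defending_strategy G D s \<longleftrightarrow>
     (\<forall>r n. (\<forall>i<n. r i \<in> verts G - guard_positions s D r i) \<longrightarrow>
        dominating_set G (guard_positions s D r n) \<and>
        (r n \<in> verts G - guard_positions s D r n \<longrightarrow>
           s (map r [0..<Suc n]) \<in> guard_positions s D r n \<and>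
           s (map r [0..<Suc n]) \<rightarrow>\<^bsub>G\<^esub> r n))"

definition eternal_dominating_set :: "('a, 'b) pre_digraph \<Rightarrow> 'a set \<Rightarrow> bool" where
  "eternal_dominating_set G D \<longleftrightarrow> (\<exists>s. defending_strategy G D s)"

definition eternal_domination_number :: "('a, 'b) pre_digraph \<Rightarrow> nat" where
  "eternal_domination_number G = (LEAST k. \<exists>D. eternal_dominating_set G D \<and> card D = k)"

definition clique_partition :: "('a, 'b) pre_digraph \<Rightarrow> 'a set set \<Rightarrow> bool" where
  "clique_partition G P \<longleftrightarrow>
     partition_on (verts G) P \<and> (\<forall>W \<in> P. K\<^bsub>card W\<^esub> (G \<restriction> W))"

definition clique_covering_number :: "('a, 'b) pre_digraph \<Rightarrow> nat" where
  "clique_covering_number G = (LEAST k. \<exists>P. clique_partition G P \<and> card P = k)"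

text \<open>The three minima are taken over nonempty sets.\<close>

lemma dominating_set_verts: "dominating_set G (verts G)"
  by (simp add: dominating_set_def)

lemma eternal_dominating_set_verts: "eternal_dominating_set G (verts G)"
proof -
  have "n = 0" if "\<forall>i<n. r i \<in> verts G - guard_positions s (verts G) r i"
    for s and r :: "nat \<Rightarrow> 'a" and n
    using that by (cases n) auto
  then have "defending_strategy G (verts G) s" for s
    unfolding defending_strategy_def by (fastforce simp: dominating_set_verts)
  then show ?thesis
    by (auto simp: eternal_dominating_set_def)
qed

lemma clique_partition_singletons:
  assumes "graph G"
  shows "clique_partition G ((\<lambda>v. {v}) ` verts G)"
proof -
  interpret graph G by fact
  have arcs: "arcs (G \<restriction> {v}) = {}" for v
    using no_loops by fastforce
  then have "arcs_ends (G \<restriction> {v}) = {}" for v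
    by (simp add: arcs_ends_def)
  moreover have "graph (G \<restriction> {v})" for v
    by unfold_locales (simp_all add: arcs symmetric_def arcs_ends_def sym_def del: induce_subgraph_arcs)
  ultimately show ?thesis
    by (auto simp: clique_partition_def complete_digraph_def partition_on_def disjoint_def)
qed

end

theory Submission
  imports Defs
begin

text \<open>
  Among the eternal dominating sets of size \<open>\<gamma>\<close>, choose \<open>D\<close> inducing the largest number of edges.
  If \<open>u\<close> is an external private neighbour of \<open>v \<in> D\<close> and the guard on \<open>v\<close> moves to \<open>w \<noteq> u\<close>, then
  afterwards \<open>u\<close> can only be dominated by \<open>w\<close>, and \<open>u, v, w\<close> is a triangle; so every vertex of \<open>D\<close>
  has at most one external private neighbour. Now let \<open>b\<close> be attacked and defended from \<open>v\<close>. If \<open>v\<close>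
  has a private neighbour, then it is \<open>b\<close>. If not, then \<open>v\<close> is isolated in \<open>D\<close>, because otherwise
  \<open>D - {v}\<close> would dominate; since the move must not add edges, \<open>b\<close> has no neighbour in \<open>D\<close> except
  \<open>v\<close>. So every vertex outside \<open>D\<close> is a private neighbour of exactly one vertex of \<open>D\<close>, and
  \<open>D\<close> together with its private neighbours is a partition into cliques of size one or two.
\<close>

section \<open>Eternal dominating sets as a greatest fixed point\<close>

lemma eternal_dominating_set_dominating:
  assumes "eternal_dominating_set G D"
  shows "dominating_set G D"
proof -
  obtain s where "defending_strategy G D s"
    using assms unfolding eternal_dominating_set_def by blast
  from this[unfolded defending_strategy_def, rule_format, of 0 undefined] show ?thesis
    by simp
qed

text \<open>Lets a play be cut after its first round: the rest of the play starts from the new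
  position and follows the residual strategy, which restores the missing first attack
  \<open>r\<close> at the head of the history.\<close>

lemma guard_positions_case_nat:
  "guard_positions s D (case_nat r \<rho>) (Suc n) =
   guard_positions (\<lambda>xs. s (r # xs)) (insert r (D - {s [r]})) \<rho> n"
proof (induction n)
  case 0
  show ?case by simp
next
  case (Suc n)
  have "map (case_nat r \<rho>) [0..<Suc (Suc n)] = r # map \<rho> [0..<Suc n]"
    by (simp add: upt_conv_Cons map_Suc_upt[symmetric] del: upt_Suc)
  then show ?case
    unfolding guard_positions.simps(2)[of s D _ "Suc n"]
      guard_positions.simps(2)[of "\<lambda>xs. s (r # xs)"] Suc.IH
    by (simp del: upt_Suc)
qed

text \<open>Every legal play of the residual strategy becomes a legal play of \<open>s\<close> once
  \<open>r\<close> is put in front, so the position after one answer is again eternally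
  dominating.\<close>

lemma eternal_dominating_set_step:
  assumes "eternal_dominating_set G D" "r \<in> verts G - D"
  obtains v where "v \<in> D" "v \<rightarrow>\<^bsub>G\<^esub> r" "eternal_dominating_set G (insert r (D - {v}))"
proof -
  obtain s where s: "defending_strategy G D s"
    using assms(1) unfolding eternal_dominating_set_def by blast
  let ?D = "insert r (D - {s [r]})"
  have "defending_strategy G ?D (\<lambda>xs. s (r # xs))"
    unfolding defending_strategy_def
  proof (intro allI impI)
    fix \<rho> :: "nat \<Rightarrow> 'a" and n
    assume legal: "\<forall>i<n. \<rho> i \<in> verts G - guard_positions (\<lambda>xs. s (r # xs)) ?D \<rho> i"
    have "\<forall>i<Suc n. case_nat r \<rho> i \<in> verts G - guard_positions s D (case_nat r \<rho>) i"
    proof (intro allI impI)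
      fix i assume "i < Suc n"
      then show "case_nat r \<rho> i \<in> verts G - guard_positions s D (case_nat r \<rho>) i"
        using legal assms(2)
        by (cases i) (simp_all add: guard_positions_case_nat del: guard_positions.simps(2))
    qed
    moreover have "map (case_nat r \<rho>) [0..<Suc (Suc n)] = r # map \<rho> [0..<Suc n]"
      by (simp add: upt_conv_Cons map_Suc_upt[symmetric] del: upt_Suc)
    ultimately show "dominating_set G (guard_positions (\<lambda>xs. s (r # xs)) ?D \<rho> n) \<and>
        (\<rho> n \<in> verts G - guard_positions (\<lambda>xs. s (r # xs)) ?D \<rho> n \<longrightarrow>
           s (r # map \<rho> [0..<Suc n]) \<in> guard_positions (\<lambda>xs. s (r # xs)) ?D \<rho> n \<and>
           s (r # map \<rho> [0..<Suc n]) \<rightarrow>\<^bsub>G\<^esub> \<rho> n)"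
      using s[unfolded defending_strategy_def, rule_format, of "Suc n" "case_nat r \<rho>"]
      by (simp add: guard_positions_case_nat del: guard_positions.simps(2) upt_Suc)
  qed
  then have "eternal_dominating_set G ?D"
    unfolding eternal_dominating_set_def by blast
  moreover have "s [r] \<in> D" "s [r] \<rightarrow>\<^bsub>G\<^esub> r"
    \<comment> \<open>Round 0 has no earlier attacks, so legality is vacuous and only the first
      attack of the constant sequence matters.\<close>
    using s[unfolded defending_strategy_def, rule_format, of 0 "\<lambda>_. r"] assms(2) by simp_all
  ultimately show thesis
    using that by blast
qed

text \<open>Converse of the one-step unfolding: a family of dominating sets closed under answering
  attacks yields a strategy, by fixing one good answer for each position and attack.\<close>

lemma eternal_dominating_set_coinduct:
  assumes "D \<in> F"
    and dom: "\<And>D. D \<in> F \<Longrightarrow> dominating_set G D"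
    and step: "\<And>D r. D \<in> F \<Longrightarrow> r \<in> verts G - D \<Longrightarrow>
      \<exists>v\<in>D. v \<rightarrow>\<^bsub>G\<^esub> r \<and> insert r (D - {v}) \<in> F"
  shows "eternal_dominating_set G D"
proof -
  obtain c where c: "c D r \<in> D" "c D r \<rightarrow>\<^bsub>G\<^esub> r" "insert r (D - {c D r}) \<in> F"
    if "D \<in> F" "r \<in> verts G - D" for D r
    using step by metis
  \<comment> \<open>A strategy sees only the attacks, so it recovers the current position by
    replaying all of them except the last.\<close>
  define pos where "pos = foldl (\<lambda>D r. insert r (D - {c D r})) D"
  define s where "s xs = c (pos (butlast xs)) (last xs)" for xs
  have pos: "guard_positions s D r n = pos (map r [0..<n])" for r n
    by (induction n) (simp_all add: pos_def s_def)
  have inF: "pos (map r [0..<n]) \<in> F"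
    if "\<forall>i<n. r i \<in> verts G - pos (map r [0..<i])" for r n
    using that
  proof (induction n)
    case 0
    show ?case using assms(1) by (simp add: pos_def)
  next
    case (Suc n)
    then show ?case using c(3)[of "pos (map r [0..<n])" "r n"] by (simp add: pos_def)
  qed
  have "defending_strategy G D s"
    unfolding defending_strategy_def pos
    using inF c(1,2) dom by (auto simp: s_def)
  then show ?thesis
    unfolding eternal_dominating_set_def by blast
qed

section \<open>Eternal domination and clique partitions\<close>

text \<open>Keep one guard in each clique and answer an attack with the guard of the attacked
  clique. The family \<open>F\<close> expresses this invariant.\<close>

lemma clique_partition_eternal_dominating_set:
  assumes "clique_partition G P"
  obtains D where "eternal_dominating_set G D" "card D = card P"
proof -
  have part: "\<Union>P = verts G" "disjoint P" "{} \<notin> P"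
    using assms by (auto simp: clique_partition_def partition_on_def)
  have adj: "x \<rightarrow>\<^bsub>G\<^esub> y" if "W \<in> P" "x \<in> W" "y \<in> W" "x \<noteq> y" for W x y
  proof -
    have "(x, y) \<in> arcs_ends (G \<restriction> W)"
      using assms that by (auto simp: clique_partition_def complete_digraph_def)
    then show ?thesis
      by (auto simp: arcs_ends_def arc_to_ends_def)
  qed
  define F where "F = {D. D \<subseteq> verts G \<and> (\<forall>W\<in>P. \<exists>x. D \<inter> W = {x})}"
  obtain f where f: "f W \<in> W" if "W \<in> P" for W
    using part(3) by (metis all_not_in_conv)
  have f_eq: "W = W'" if "W \<in> P" "W' \<in> P" "f W \<in> W'" for W W'
    using that f part(2) by (auto simp: disjoint_def)
  have "f ` P \<inter> W = {f W}" if "W \<in> P" for W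
    using that f f_eq by blast
  then have "f ` P \<in> F"
    using f part(1) unfolding F_def by blast
  moreover have "dominating_set G D" if "D \<in> F" for D
    unfolding dominating_set_def
  proof (intro conjI ballI)
    show "D \<subseteq> verts G"
      using that by (simp add: F_def)
    fix v assume v: "v \<in> verts G - D"
    then obtain W where "W \<in> P" "v \<in> W"
      using part(1) by blast
    moreover obtain x where "D \<inter> W = {x}"
      using \<open>W \<in> P\<close> \<open>D \<in> F\<close> by (auto simp: F_def)
    ultimately show "\<exists>u\<in>D. u \<rightarrow>\<^bsub>G\<^esub> v"
      using adj[of W x v] v by blast
  qed
  moreover have "\<exists>v\<in>D. v \<rightarrow>\<^bsub>G\<^esub> r \<and> insert r (D - {v}) \<in> F"
    if D: "D \<in> F" and r: "r \<in> verts G - D" for D r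
  proof -
    obtain W where W: "W \<in> P" "r \<in> W"
      using r part(1) by blast
    obtain x where x: "D \<inter> W = {x}"
      using \<open>W \<in> P\<close> D by (auto simp: F_def)
    have "\<exists>y. insert r (D - {x}) \<inter> W' = {y}" if W': "W' \<in> P" for W'
    proof (cases "W' = W")
      case True
      then show ?thesis using x W(2) by blast
    next
      case False
      then have "W \<inter> W' = {}"
        using W(1) W' part(2) by (auto simp: disjoint_def)
      \<comment> \<open>The move stays inside \<open>W\<close>, so all other cliques keep their
        guards.\<close>
      then have "insert r (D - {x}) \<inter> W' = D \<inter> W'"
        using x W(2) by blast
      then show ?thesis using D W' by (simp add: F_def)
    qed
    then have "insert r (D - {x}) \<in> F"
      using D r by (auto simp: F_def)
    then show ?thesis
      using adj[of W x r] W x r by blast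
  qed
  ultimately have "eternal_dominating_set G (f ` P)"
    by (rule eternal_dominating_set_coinduct)
  moreover have "card (f ` P) = card P"
    by (rule card_image) (use f f_eq in \<open>metis inj_onI\<close>)
  ultimately show thesis
    using that by blast
qed

lemma (in graph) eternal_domination_number_le_clique_covering_number:
  "eternal_domination_number G \<le> clique_covering_number G"
proof -
  have "\<exists>P. clique_partition G P \<and> card P = clique_covering_number G"
    unfolding clique_covering_number_def
    using clique_partition_singletons[OF graph_axioms] by - (rule LeastI_ex, blast)
  then obtain D where "eternal_dominating_set G D" "card D = clique_covering_number G"
    using clique_partition_eternal_dominating_set by metis
  then show ?thesis
    unfolding eternal_domination_number_def by - (rule Least_le, blast)
qed

lemma (in graph) complete_digraph_induce_subgraph:
  assumes "W \<subseteq> verts G" and adj: "\<And>x y. x \<in> W \<Longrightarrow> y \<in> W \<Longrightarrow> x \<noteq> y \<Longrightarrow> x \<rightarrow>\<^bsub>G\<^esub> y"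
  shows "K\<^bsub>card W\<^esub> (G \<restriction> W)"
proof -
  have "graph (G \<restriction> W)"
    using induced_induce[OF assms(1)] sym_arcs digraph.graphI digraphI_induced
      induced_graph_imp_symmetric by metis
  moreover have "arcs_ends (G \<restriction> W) = {(u, v). (u, v) \<in> W \<times> W \<and> u \<noteq> v}"
  proof (intro equalityI subsetI)
    fix p assume "p \<in> arcs_ends (G \<restriction> W)"
    then show "p \<in> {(u, v). (u, v) \<in> W \<times> W \<and> u \<noteq> v}"
      using no_loops by (auto simp: arcs_ends_def arc_to_ends_def)
  next
    fix p assume "p \<in> {(u, v). (u, v) \<in> W \<times> W \<and> u \<noteq> v}"
    then obtain u v where p: "p = (u, v)" "u \<in> W" "v \<in> W" "u \<noteq> v" by auto
    then have "(u, v) \<in> arcs_ends G" using adj by blast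
    then show "p \<in> arcs_ends (G \<restriction> W)"
      using p by (auto simp: arcs_ends_def arc_to_ends_def)
  qed
  ultimately show ?thesis
    by (simp add: complete_digraph_def)
qed

section \<open>Private neighbours\<close>

text \<open>Meant for \<open>v\<close> in \<open>D\<close>: the equivalence at \<open>x = v\<close>
  then forces adjacency to \<open>v\<close>, and at other \<open>x\<close> it excludes adjacency.
  For \<open>v\<close> outside \<open>D\<close> it describes the vertices not dominated by
  \<open>D\<close>.\<close>

definition external_private_neighbours ::
    "('a, 'b) pre_digraph \<Rightarrow> 'a set \<Rightarrow> 'a \<Rightarrow> 'a set" where
  "external_private_neighbours G D v = {u \<in> verts G - D. \<forall>x\<in>D. x \<rightarrow>\<^bsub>G\<^esub> u \<longleftrightarrow> x = v}"

text \<open>The one place where triangle-freeness enters.\<close>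

lemma (in graph) move_to_private_neighbour:
  assumes "triangle_free G" "dominating_set G (insert w (D - {v}))" "v \<in> D" "v \<rightarrow>\<^bsub>G\<^esub> w"
    and u: "u \<in> external_private_neighbours G D v"
  shows "u = w"
proof (rule ccontr)
  assume "u \<noteq> w"
  then obtain x where "x \<in> insert w (D - {v})" "x \<rightarrow>\<^bsub>G\<^esub> u"
    using assms(2) u unfolding dominating_set_def external_private_neighbours_def by blast
  then have "w \<rightarrow>\<^bsub>G\<^esub> u"
    using u unfolding external_private_neighbours_def by blast
  moreover have "u \<rightarrow>\<^bsub>G\<^esub> v"
    using u assms(3) by (auto simp: external_private_neighbours_def intro: graph_symmetric)
  ultimately show False
    using assms(1,4) unfolding triangle_free_def by blast
qed

lemma card_dominating_set_ge:
  "dominating_set G D \<Longrightarrow> domination_number G \<le> card D"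
  unfolding domination_number_def by - (rule Least_le, blast)

text \<open>Minimality of \<open>D\<close> enters here. A neighbour \<open>y\<close> in
  \<open>D\<close> would dominate \<open>v\<close>, and no vertex outside \<open>D\<close> depends
  on \<open>v\<close> alone, so the guard on \<open>v\<close> could be dropped.\<close>

lemma (in graph) isolated_if_no_private_neighbour:
  assumes D: "dominating_set G D" "card D = domination_number G"
    and v: "v \<in> D" "external_private_neighbours G D v = {}" and "y \<in> D"
  shows "\<not> y \<rightarrow>\<^bsub>G\<^esub> v"
proof
  assume "y \<rightarrow>\<^bsub>G\<^esub> v"
  have fin: "finite D"
    using D(1) finite_subset[OF _ finite_verts] by (simp add: dominating_set_def)
  have "y \<noteq> v"
    using \<open>y \<rightarrow>\<^bsub>G\<^esub> v\<close> adj_not_same by blast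
  have "dominating_set G (D - {v})"
    unfolding dominating_set_def
  proof (intro conjI ballI)
    show "D - {v} \<subseteq> verts G"
      using D(1) by (auto simp: dominating_set_def)
    fix u assume u: "u \<in> verts G - (D - {v})"
    show "\<exists>x\<in>D - {v}. x \<rightarrow>\<^bsub>G\<^esub> u"
    proof (cases "u = v")
      case True
      then show ?thesis
        using \<open>y \<rightarrow>\<^bsub>G\<^esub> v\<close> \<open>y \<noteq> v\<close> \<open>y \<in> D\<close> by blast
    next
      case False
      then have "u \<in> verts G - D"
        using u by blast
      moreover have "u \<notin> external_private_neighbours G D v"
        using v(2) by simp
      ultimately show ?thesis
        using D(1) unfolding dominating_set_def external_private_neighbours_def by blast
    qed
  qed
  then have "domination_number G \<le> card (D - {v})"
    by (rule card_dominating_set_ge)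
  also have "\<dots> < card D"
    using fin v(1) by (rule card_Diff1_less)
  finally show False
    using D(2) by simp
qed

text \<open>By \<open>unique\<close>, each block is a single vertex or an edge. Blocks are disjoint
  because a vertex cannot be private to two members of \<open>D\<close>.\<close>

lemma (in graph) clique_partition_private_neighbours:
  assumes D: "D \<subseteq> verts G"
    and unique: "\<And>v a b. v \<in> D \<Longrightarrow> a \<in> external_private_neighbours G D v \<Longrightarrow>
      b \<in> external_private_neighbours G D v \<Longrightarrow> a = b"
    and cover: "\<And>b. b \<in> verts G - D \<Longrightarrow> \<exists>v\<in>D. b \<in> external_private_neighbours G D v"
  shows "clique_partition G ((\<lambda>v. insert v (external_private_neighbours G D v)) ` D)"
    (is "clique_partition G (?W ` D)")
proof -
  have sub: "external_private_neighbours G D v \<subseteq> verts G - D" for v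
    by (auto simp: external_private_neighbours_def)
  show ?thesis
    unfolding clique_partition_def
  proof (intro conjI ballI)
    have "\<Union> (?W ` D) = verts G"
      using D sub cover by blast
    moreover have "?W v \<inter> ?W v' = {}" if "v \<in> D" "v' \<in> D" "v \<noteq> v'" for v v'
      using that by (auto simp: external_private_neighbours_def)
    ultimately show "partition_on (verts G) (?W ` D)"
      unfolding partition_on_def disjoint_def by fastforce
  next
    fix W assume "W \<in> ?W ` D"
    then obtain v where v: "v \<in> D" "W = ?W v" by blast
    have "v \<rightarrow>\<^bsub>G\<^esub> u" if "u \<in> external_private_neighbours G D v" for u
      using that v(1) by (auto simp: external_private_neighbours_def)
    then have "v \<rightarrow>\<^bsub>G\<^esub> u" "u \<rightarrow>\<^bsub>G\<^esub> v" if "u \<in> external_private_neighbours G D v" for u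
      using that graph_symmetric by blast+
    then have "x \<rightarrow>\<^bsub>G\<^esub> y" if "x \<in> W" "y \<in> W" "x \<noteq> y" for x y
      using that v unique[OF v(1)] by blast
    moreover have "W \<subseteq> verts G"
      using v D sub by blast
    ultimately show "K\<^bsub>card W\<^esub> (G \<restriction> W)"
      by (intro complete_digraph_induce_subgraph)
  qed
qed

section \<open>Maximizing the number of induced edges\<close>

lemma (in graph) clique_partition_of_eternal_dominating_set:
  assumes "triangle_free G"
    and D0: "eternal_dominating_set G D0" "card D0 = domination_number G"
  obtains P where "clique_partition G P" "card P \<le> domination_number G"
proof -
  define Q where "Q D \<longleftrightarrow> eternal_dominating_set G D \<and> card D = domination_number G" for D
  \<comment> \<open>Ordered pairs count each induced edge twice, which does not affect
    comparisons.\<close>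
  define E where "E D = {(x, y) \<in> D \<times> D. x \<rightarrow>\<^bsub>G\<^esub> y}" for D
  have Q_sub: "D \<subseteq> verts G" if "Q D" for D
    using that eternal_dominating_set_dominating by (auto simp: Q_def dominating_set_def)
  have fin_E: "finite (E D)" if "Q D" for D
    by (rule finite_subset[of _ "verts G \<times> verts G"]) (use Q_sub[OF that] in \<open>auto simp: E_def\<close>)
  \<comment> \<open>This uniform bound makes a maximum exist.\<close>
  have "card (E D) \<le> card (verts G \<times> verts G)" if "Q D" for D
    by (rule card_mono) (use Q_sub[OF that] in \<open>auto simp: E_def\<close>)
  then have "\<forall>D. Q D \<longrightarrow> card (E D) < Suc (card (verts G \<times> verts G))"
    by (simp add: le_imp_less_Suc)
  moreover have "Q D0"
    using D0 by (simp add: Q_def)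
  ultimately obtain D where D: "Q D" and max: "\<And>D'. Q D' \<Longrightarrow> card (E D') \<le> card (E D)"
    using ex_has_greatest_nat[of Q D0 "\<lambda>D. card (E D)"] by blast
  have fin: "finite D"
    by (rule finite_subset[OF Q_sub[OF D] finite_verts])
  have dom: "dominating_set G D" and card: "card D = domination_number G"
    using D eternal_dominating_set_dominating by (auto simp: Q_def)
  have step: "\<exists>v\<in>D. v \<rightarrow>\<^bsub>G\<^esub> r \<and> Q (insert r (D - {v}))" if r: "r \<in> verts G - D" for r
  proof -
    obtain v where v: "v \<in> D" "v \<rightarrow>\<^bsub>G\<^esub> r" "eternal_dominating_set G (insert r (D - {v}))"
      using eternal_dominating_set_step[OF _ r] D unfolding Q_def by metis
    moreover have "card (insert r (D - {v})) = card D"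
      using v(1) r fin card_Suc_Diff1[of D v] by (simp del: card_Diff_singleton)
    ultimately show ?thesis
      using card by (auto simp: Q_def)
  qed
  have moved: "u = w"
    if "Q (insert w (D - {v}))" "v \<in> D" "v \<rightarrow>\<^bsub>G\<^esub> w" "u \<in> external_private_neighbours G D v" for u v w
    using move_to_private_neighbour[OF assms(1) _ that(2-4)] that(1)
      eternal_dominating_set_dominating unfolding Q_def by blast
  have "\<exists>v\<in>D. b \<in> external_private_neighbours G D v" if b: "b \<in> verts G - D" for b
  proof -
    obtain v where v: "v \<in> D" "v \<rightarrow>\<^bsub>G\<^esub> b" and Q': "Q (insert b (D - {v}))"
      using step[OF b] by blast
    have "b \<in> external_private_neighbours G D v"
    proof (cases "external_private_neighbours G D v = {}")
      case False
      then show ?thesis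
        using moved[OF Q' v] by blast
    next
      case True
      then have iso: "\<not> y \<rightarrow>\<^bsub>G\<^esub> v" "\<not> v \<rightarrow>\<^bsub>G\<^esub> y" if "y \<in> D" for y
        using isolated_if_no_private_neighbour[OF dom card v(1)] that graph_symmetric by blast+
      show ?thesis
      proof (rule ccontr)
        assume "b \<notin> external_private_neighbours G D v"
        then obtain y where y: "y \<in> D" "y \<noteq> v" "y \<rightarrow>\<^bsub>G\<^esub> b"
          using v b by (auto simp: external_private_neighbours_def)
        \<comment> \<open>No edge is lost when the guard leaves \<open>v\<close>, since
          \<open>v\<close> is isolated in \<open>D\<close>; the edge from \<open>y\<close> to
          \<open>b\<close> is gained.\<close>
        have "E D \<subseteq> E (insert b (D - {v}))"
          using iso by (auto simp: E_def)
        moreover have "(y, b) \<in> E (insert b (D - {v})) - E D"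
          using y b by (auto simp: E_def)
        ultimately have "card (E D) < card (E (insert b (D - {v})))"
          by (intro psubset_card_mono fin_E[OF Q']) blast
        then show False
          using max[OF Q'] by simp
      qed
    qed
    then show ?thesis
      using v(1) by blast
  qed
  moreover have "a = b"
    if ab: "a \<in> external_private_neighbours G D v" "b \<in> external_private_neighbours G D v" for v a b
  proof -
    have "a \<in> verts G - D"
      using ab(1) by (simp add: external_private_neighbours_def)
    \<comment> \<open>Attack \<open>a\<close> itself: only the guard on \<open>v\<close> can answer,
      and \<open>moved\<close> then identifies every private neighbour of \<open>v\<close> with
      \<open>a\<close>.\<close>
    then obtain x where x: "x \<in> D" "x \<rightarrow>\<^bsub>G\<^esub> a" "Q (insert a (D - {x}))"
      using step by blast
    then have "x = v"
      using ab(1) by (simp add: external_private_neighbours_def)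
    then show ?thesis
      using moved[of a x b] x ab(2) by simp
  qed
  ultimately have "clique_partition G ((\<lambda>v. insert v (external_private_neighbours G D v)) ` D)"
    using clique_partition_private_neighbours[OF Q_sub[OF D]] by blast
  then show thesis
    using that card_image_le[OF fin] card by metis
qed

theorem theorem6p6:
  fixes G :: "('a, 'b) pre_digraph"
  assumes "graph G"
    and "triangle_free G"
    and "eternal_domination_number G = domination_number G"
  shows "eternal_domination_number G = clique_covering_number G"
proof (rule antisym)
  interpret graph G by fact
  show "eternal_domination_number G \<le> clique_covering_number G"
    by (rule eternal_domination_number_le_clique_covering_number)
  \<comment> \<open>The minimum is attained; by hypothesis the set attaining it has the size of a
    minimum dominating set.\<close>
  have "\<exists>D. eternal_dominating_set G D \<and> card D = eternal_domination_number G"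
    unfolding eternal_domination_number_def
    using eternal_dominating_set_verts[of G] by - (rule LeastI_ex, blast)
  then obtain P where P: "clique_partition G P" "card P \<le> domination_number G"
    using clique_partition_of_eternal_dominating_set assms(2,3) by metis
  have "clique_covering_number G \<le> card P"
    unfolding clique_covering_number_def by (rule Least_le) (use P(1) in blast)
  then show "clique_covering_number G \<le> eternal_domination_number G"
    using P(2) assms(3) by simp
qed

end
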